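(* Let $\beta\ge 0$ be a real number. If $\omega:S\to\mathbb{R}$ is a modulus of continuity function on the simplex $S$, then for all $n\in\mathbb{N}$ the function $G_n^{\beta}(\omega):\mathbf{x}\mapsto G_n^{\beta}(\omega;\mathbf{x})$ on $S$ is also a modulus of continuity function.
   Context: $\mathbb{N}=\{1,2,\dots\}$ and $\mathbb{N}_0=\mathbb{N}\cup\{0\}$. The two-dimensional simplex is $S=\{\mathbf{x}=(x_1,x_2)\in\mathbb{R}^2: x_1,x_2\ge 0,\ x_1+x_2\le 1\}$. For $\mathbf{x}=(x_1,x_2)\in\mathbb{R}^2$ and $\mathbf{k}=(k_1,k_2)\in\mathbb{N}_0^2$ write $|\mathbf{x}|=x_1+x_2$, $|\mathbf{k}|=k_1+k_2$, $\mathbf{k}/n=(k_1/n,k_2/n)$, and $\binom{n}{\mathbf{k}}=\frac{n!}{k_1!\,k_2!\,(n-|\mathbf{k}|)!}$ for $|\mathbf{k}|\le n$. Write $\mathbf{0}=(0,0)$, and $\mathbf{x}\le\mathbf{y}$ means $x_i\le y_i$ for $i=1,2$. Bivariate (non-tensor product) Cheney-Sharma operators: for a real parameter $\beta\ge 0$, $n\in\mathbb{N}$, a continuous function $f:S\to\mathbb{R}$ and $\mathbf{x}\in S$, $$G_n^{\beta}(f;\mathbf{x})=(1+n\beta)^{1-n}\sum_{k_1=0}^{n}\sum_{k_2=0}^{n-k_1} f\left(\frac{\mathbf{k}}{n}\right)\binom{n}{\mathbf{k}}\,x_1(x_1+k_1\beta)^{k_1-1}\,x_2(x_2+k_2\beta)^{k_2-1}\,(1-|\mathbf{x}|)\left[1-|\mathbf{x}|+(n-|\mathbf{k}|)\beta\right]^{n-|\mathbf{k}|-1}.$$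 Here each factor of the form $t(t+j\beta)^{j-1}$ with $j\in\mathbb{N}_0$ and $t\ge 0$ is understood as the polynomial in $t$ it represents: it equals $1$ when $j=0$ (also at $t=0$), and it equals $t^j$ when $\beta=0$ (with $t^0=1$). Modulus of continuity function: a nonnegative continuous function $\omega:S\to\mathbb{R}$ is called a modulus of continuity function if (a) $\omega(\mathbf{0})=0$; (b) $\omega$ is non-decreasing, i.e. $\omega(\mathbf{u})\ge\omega(\mathbf{v})$ for all $\mathbf{u},\mathbf{v}\in S$ with $\mathbf{u}\ge\mathbf{v}$; (c) $\omega$ is semi-additive, i.e. $\omega(\mathbf{u}+\mathbf{v})\le\omega(\mathbf{u})+\omega(\mathbf{v})$ for all $\mathbf{u},\mathbf{v}\in S$ with $\mathbf{u}+\mathbf{v}\in S$. *)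

theory Defs
  imports "HOL-Analysis.Analysis"
begin

definition simplex2 :: "(real \<times> real) set" where
  "simplex2 = {(x1, x2). 0 \<le> x1 \<and> 0 \<le> x2 \<and> x1 + x2 \<le> 1}"

definition multichoose2 :: "nat \<Rightarrow> nat \<Rightarrow> nat \<Rightarrow> real" where
  "multichoose2 n k1 k2 = fact n / (fact k1 * fact k2 * fact (n - (k1 + k2)))"

text \<open>
  The expression \<open>t (t + j \<beta>)\<^bsup>j-1\<^esup>\<close>, read as a polynomial in \<open>t\<close>. For \<open>j = 0\<close> it is
  \<open>t \<cdot> t\<^bsup>-1\<^esup>\<close>, i.e. the constant \<open>1\<close>, also at \<open>t = 0\<close>.
\<close>

definition abel_factor :: "real \<Rightarrow> nat \<Rightarrow> real \<Rightarrow> real" where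
  "abel_factor \<beta> j t = (if j = 0 then 1 else t * (t + real j * \<beta>) ^ (j - 1))"

definition cheney_sharma ::
  "real \<Rightarrow> nat \<Rightarrow> (real \<times> real \<Rightarrow> real) \<Rightarrow> real \<times> real \<Rightarrow> real" where
  "cheney_sharma \<beta> n f = (\<lambda>(x1, x2).
     (1 + real n * \<beta>) powi (1 - int n) *
     (\<Sum>k1 = 0..n. \<Sum>k2 = 0..n - k1.
        f (real k1 / real n, real k2 / real n) * multichoose2 n k1 k2 *
        abel_factor \<beta> k1 x1 * abel_factor \<beta> k2 x2 *
        abel_factor \<beta> (n - (k1 + k2)) (1 - (x1 + x2))))"

text \<open>The order on \<open>real \<times> real\<close> is the componentwise one.\<close>

definition modulus_of_continuity :: "(real \<times> real \<Rightarrow> real) \<Rightarrow> bool" where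
  "modulus_of_continuity \<omega> \<longleftrightarrow>
     continuous_on simplex2 \<omega> \<and>
     (\<forall>u\<in>simplex2. 0 \<le> \<omega> u) \<and>
     \<omega> (0, 0) = 0 \<and>
     (\<forall>u\<in>simplex2. \<forall>v\<in>simplex2. v \<le> u \<longrightarrow> \<omega> v \<le> \<omega> u) \<and>
     (\<forall>u\<in>simplex2. \<forall>v\<in>simplex2. u + v \<in> simplex2 \<longrightarrow> \<omega> (u + v) \<le> \<omega> u + \<omega> v)"

end

theory Submission
  imports Defs
begin

text \<open>
  The normalized Abel polynomials \<open>a\<^sub>j(t) = t (t + j \<beta>)\<^bsup>j-1\<^esup> / j!\<close> are of convolution type:
  \<open>a\<^sub>n(s + t) = (\<Sum>k\<le>n. a\<^sub>k(s) a\<^bsub>n-k\<^esub>(t))\<close>. Splitting \<open>1 - |x|\<close> as \<open>z\<^sub>1 + z\<^sub>2 + (1 - |x + z|)\<close>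
  and \<open>x + z\<close> componentwise therefore writes \<open>G f x\<close>, \<open>G f z\<close> and \<open>G f (x + z)\<close> as sums over the
  same indices with the same nonnegative weights, in which \<open>f\<close> is evaluated at \<open>i / n\<close>, \<open>q / n\<close> and
  \<open>(i + q) / n\<close>, respectively. Monotonicity and semi-additivity then hold termwise.
\<close>

definition abel_poly :: "real \<Rightarrow> nat \<Rightarrow> real \<Rightarrow> real" where
  "abel_poly \<beta> j t = abel_factor \<beta> j t / fact j"

lemma abel_poly_0 [simp]: "abel_poly \<beta> 0 t = 1"
  by (simp add: abel_poly_def abel_factor_def)

lemma abel_poly_at_0: "abel_poly \<beta> j 0 = (if j = 0 then 1 else 0)"
  by (simp add: abel_poly_def abel_factor_def)

lemma abel_poly_nonneg: "\<beta> \<ge> 0 \<Longrightarrow> t \<ge> 0 \<Longrightarrow> abel_poly \<beta> j t \<ge> 0"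
  by (simp add: abel_poly_def abel_factor_def)

text \<open>Differentiation acts as index lowering combined with a shift by \<open>\<beta>\<close>.
  This holds because \<open>t + (n + 1) * \<beta>\<close> equals
  \<open>(t + \<beta>) + n * \<beta>\<close>, the base occurring in the polynomial of index
  \<open>n\<close> at \<open>t + \<beta>\<close>.\<close>

lemma DERIV_abel_poly_Suc:
  "(abel_poly \<beta> (Suc n) has_real_derivative abel_poly \<beta> n (t + \<beta>)) (at t)"
proof -
  have "((\<lambda>t. t * (t + real (Suc n) * \<beta>) ^ n / fact (Suc n)) has_real_derivative
      ((t + real (Suc n) * \<beta>) ^ n + t * (real n * (t + real (Suc n) * \<beta>) ^ (n - 1))) / fact (Suc n)) (at t)"
    by (auto intro!: derivative_eq_intros)
  moreover have "((t + real (Suc n) * \<beta>) ^ n + t * (real n * (t + real (Suc n) * \<beta>) ^ (n - 1))) / fact (Suc n)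
      = abel_poly \<beta> n (t + \<beta>)"
  proof (cases n)
    case 0
    then show ?thesis by simp
  next
    case (Suc m)
    define u where "u = t + real (Suc n) * \<beta>"
    \<comment> \<open>Factor out \<open>u ^ m\<close>: the cofactor is
      \<open>u + n * t = (n + 1) * (t + \<beta>)\<close>, and \<open>n + 1\<close> cancels against
      the factorial.\<close>
    have "u ^ n + t * (real n * u ^ (n - 1)) = real (Suc n) * ((t + \<beta>) * u ^ m)"
      using Suc by (simp add: u_def algebra_simps)
    then have "(u ^ n + t * (real n * u ^ (n - 1))) / fact (Suc n) = (t + \<beta>) * u ^ m / fact n"
      by simp
    moreover have "abel_poly \<beta> n (t + \<beta>) = (t + \<beta>) * u ^ m / fact n"
      using Suc by (simp add: abel_poly_def abel_factor_def u_def algebra_simps)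
    ultimately show ?thesis
      by (simp only: u_def)
  qed
  moreover have "abel_poly \<beta> (Suc n) = (\<lambda>t. t * (t + real (Suc n) * \<beta>) ^ n / fact (Suc n))"
    by (simp add: abel_poly_def abel_factor_def fun_eq_iff)
  ultimately show ?thesis by simp
qed

text \<open>Abel's binomial theorem: both sides have the same \<open>s\<close>-derivative and agree at \<open>s = 0\<close>.\<close>

lemma abel_poly_add:
  "abel_poly \<beta> n (s + t) = (\<Sum>k\<le>n. abel_poly \<beta> k s * abel_poly \<beta> (n - k) t)"
proof (induction n arbitrary: s)
  case 0
  show ?case by simp
next
  case (Suc n)
  define h where "h s = (\<Sum>k\<le>Suc n. abel_poly \<beta> k s * abel_poly \<beta> (Suc n - k) t)
      - abel_poly \<beta> (Suc n) (s + t)" for s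
  \<comment> \<open>The term \<open>k = 0\<close> is split off: it is constant in \<open>s\<close>,
    and every remaining factor has a successor index, as the derivative rule requires.\<close>
  have h_alt: "h = (\<lambda>s. abel_poly \<beta> (Suc n) t
      + (\<Sum>k\<le>n. abel_poly \<beta> (Suc k) s * abel_poly \<beta> (n - k) t) - abel_poly \<beta> (Suc n) (s + t))"
    unfolding h_def by (subst sum.atMost_Suc_shift) simp
  have "(h has_real_derivative 0) (at s)" for s
  proof -
    have shifted: "((\<lambda>s. abel_poly \<beta> (Suc n) (s + t)) has_real_derivative abel_poly \<beta> n (s + t + \<beta>)) (at s)"
      using DERIV_abel_poly_Suc [of \<beta> n "s + t"] by (simp add: DERIV_shift)
    have "(h has_real_derivative (0 + (\<Sum>k\<le>n. abel_poly \<beta> k (s + \<beta>) * abel_poly \<beta> (n - k) t))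
        - abel_poly \<beta> n (s + t + \<beta>)) (at s)"
      unfolding h_alt
      by (intro DERIV_diff DERIV_add DERIV_const DERIV_sum DERIV_cmult_right DERIV_abel_poly_Suc shifted)
    \<comment> \<open>The induction hypothesis is used at the shifted point
      \<open>s + \<beta>\<close>, hence the generalization over \<open>s\<close>.\<close>
    also have "(0 + (\<Sum>k\<le>n. abel_poly \<beta> k (s + \<beta>) * abel_poly \<beta> (n - k) t)) - abel_poly \<beta> n (s + t + \<beta>) = 0"
      using Suc.IH [of "s + \<beta>"] by (simp add: ac_simps)
    finally show ?thesis .
  qed
  then have "h s = h 0"
    by (simp add: DERIV_const_ratio_const DERIV_isconst_all)
  also have "h 0 = 0"
    by (simp add: h_alt abel_poly_at_0)
  finally show ?case by (simp add: h_def)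
qed

text \<open>The multinomial denominators are absorbed into the normalized polynomials; only
  \<open>fact n\<close> stays outside.\<close>

lemma cheney_sharma_altdef:
  "cheney_sharma \<beta> n f (x1, x2) = (1 + real n * \<beta>) powi (1 - int n) * fact n *
     (\<Sum>k1\<le>n. \<Sum>k2\<le>n - k1. f (real k1 / real n, real k2 / real n) *
        (abel_poly \<beta> k1 x1 * abel_poly \<beta> k2 x2 * abel_poly \<beta> (n - (k1 + k2)) (1 - (x1 + x2))))"
  by (simp add: cheney_sharma_def multichoose2_def abel_poly_def atMost_atLeast0
      sum_distrib_left mult_ac)

text \<open>The pair \<open>(i, j)\<close> belongs to the coordinates of \<open>x\<close> and
  \<open>(q, r)\<close> to those of \<open>z\<close>; the rest of \<open>n\<close> goes to the slack
  \<open>1 - |x| - |z|\<close>.\<close>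

definition quad_indices :: "nat \<Rightarrow> (nat \<times> nat \<times> nat \<times> nat) set" where
  "quad_indices n = {(i, j, q, r). i + j + q + r \<le> n}"

lemma finite_quad_indices: "finite (quad_indices n)"
  by (rule finite_subset [of _ "{..n} \<times> {..n} \<times> {..n} \<times> {..n}"]) (auto simp: quad_indices_def)

definition quad_weight ::
  "real \<Rightarrow> nat \<Rightarrow> real \<times> real \<Rightarrow> real \<times> real \<Rightarrow> nat \<times> nat \<times> nat \<times> nat \<Rightarrow> real" where
  "quad_weight \<beta> n x z = (\<lambda>(i, j, q, r).
     (1 + real n * \<beta>) powi (1 - int n) * fact n *
     (abel_poly \<beta> i (fst x) * abel_poly \<beta> j (snd x) * abel_poly \<beta> q (fst z) * abel_poly \<beta> r (snd z) *
      abel_poly \<beta> (n - (i + j + q + r)) (1 - (fst x + snd x + fst z + snd z))))"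

lemma quad_weight_nonneg:
  assumes "\<beta> \<ge> 0" "x \<in> simplex2" "z \<in> simplex2" "x + z \<in> simplex2"
  shows "quad_weight \<beta> n x z idx \<ge> 0"
  using assms
  by (auto simp: quad_weight_def simplex2_def split: prod.splits
      intro!: mult_nonneg_nonneg abel_poly_nonneg)

lemma quad_weight_swap:
  "quad_weight \<beta> n z x (q, r, i, j) = quad_weight \<beta> n x z (i, j, q, r)"
  by (simp add: quad_weight_def ac_simps)

text \<open>Only the last factor is expanded, by applying the convolution identity twice to
  \<open>1 - |x| = z1 + (z2 + s)\<close>.\<close>

lemma cheney_sharma_expand_left:
  "cheney_sharma \<beta> n f x =
     (\<Sum>(i, j, q, r)\<in>quad_indices n. f (real i / real n, real j / real n) * quad_weight \<beta> n x z (i, j, q, r))"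
proof -
  obtain x1 x2 z1 z2 where xz: "x = (x1, x2)" "z = (z1, z2)"
    by (metis surj_pair)
  define s where "s = 1 - (x1 + x2 + z1 + z2)"
  define C where "C = (1 + real n * \<beta>) powi (1 - int n) * fact n"
  have split: "abel_poly \<beta> m (1 - (x1 + x2)) =
      (\<Sum>q\<le>m. \<Sum>r\<le>m - q. abel_poly \<beta> q z1 * abel_poly \<beta> r z2 * abel_poly \<beta> (m - (q + r)) s)" for m
  proof -
    have "1 - (x1 + x2) = z1 + (z2 + s)"
      by (simp add: s_def)
    then show ?thesis
      by (simp add: abel_poly_add sum_distrib_left mult_ac)
  qed
  have "cheney_sharma \<beta> n f x = (\<Sum>k1\<le>n. \<Sum>k2\<le>n - k1. \<Sum>q\<le>n - (k1 + k2). \<Sum>r\<le>n - (k1 + k2) - q.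
      f (real k1 / real n, real k2 / real n) * (C * (abel_poly \<beta> k1 x1 * abel_poly \<beta> k2 x2 *
        abel_poly \<beta> q z1 * abel_poly \<beta> r z2 * abel_poly \<beta> (n - (k1 + k2) - (q + r)) s)))"
    unfolding xz cheney_sharma_altdef split C_def by (simp add: sum_distrib_left mult_ac)
  \<comment> \<open>Once the nested sums are merged, the tuples already match, so the identity is
    the bijection; the nested bounds together say \<open>i + j + q + r \<le> n\<close>.\<close>
  also have "\<dots> = (\<Sum>(i, j, q, r)\<in>quad_indices n.
      f (real i / real n, real j / real n) * quad_weight \<beta> n x z (i, j, q, r))"
    by (simp only: sum.Sigma finite_atMost finite_SigmaI Ball_def simp_thms split_def,
      rule sum.reindex_bij_witness [where i = "\<lambda>(i, j, q, r). (i, j, q, r)" and j = "\<lambda>(i, j, q, r). (i, j, q, r)"])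
      (auto simp: quad_indices_def quad_weight_def xz C_def s_def add.assoc)
  finally show ?thesis .
qed

text \<open>The left expansion with \<open>x\<close> and \<open>z\<close> exchanged; the symmetry of
  the weight restores the common form.\<close>

lemma cheney_sharma_expand_right:
  "cheney_sharma \<beta> n f z =
     (\<Sum>(i, j, q, r)\<in>quad_indices n. f (real q / real n, real r / real n) * quad_weight \<beta> n x z (i, j, q, r))"
  unfolding cheney_sharma_expand_left [of \<beta> n f z x]
  by (rule sum.reindex_bij_witness [where i = "\<lambda>(i, j, q, r). (q, r, i, j)" and j = "\<lambda>(i, j, q, r). (q, r, i, j)"])
    (auto simp: quad_indices_def quad_weight_swap)

text \<open>Here the first two factors are expanded, at \<open>x1 + z1\<close> and
  \<open>x2 + z2\<close>, while the slack factor stays intact.\<close>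

lemma cheney_sharma_expand_add:
  "cheney_sharma \<beta> n f (x + z) =
     (\<Sum>(i, j, q, r)\<in>quad_indices n.
        f (real (i + q) / real n, real (j + r) / real n) * quad_weight \<beta> n x z (i, j, q, r))"
proof -
  obtain x1 x2 z1 z2 where xz: "x = (x1, x2)" "z = (z1, z2)"
    by (metis surj_pair)
  define s where "s = 1 - (x1 + x2 + z1 + z2)"
  define C where "C = (1 + real n * \<beta>) powi (1 - int n) * fact n"
  have s_eq: "1 - (x1 + z1 + (x2 + z2)) = s"
    by (simp add: s_def)
  have "cheney_sharma \<beta> n f (x + z) = (\<Sum>k1\<le>n. \<Sum>k2\<le>n - k1. \<Sum>i\<le>k1. \<Sum>j\<le>k2.
      f (real k1 / real n, real k2 / real n) * (C * (abel_poly \<beta> i x1 * abel_poly \<beta> j x2 *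
        abel_poly \<beta> (k1 - i) z1 * abel_poly \<beta> (k2 - j) z2 * abel_poly \<beta> (n - (k1 + k2)) s)))"
    unfolding xz add_Pair cheney_sharma_altdef s_eq abel_poly_add [of \<beta> _ x1 z1] abel_poly_add [of \<beta> _ x2 z2]
      sum_product C_def
    by (simp add: sum_distrib_left sum_distrib_right mult_ac)
  \<comment> \<open>Substitute \<open>q = k1 - i\<close> and \<open>r = k2 - j\<close>; the bounds
    \<open>i \<le> k1\<close> and \<open>j \<le> k2\<close> make these natural subtractions
    exact.\<close>
  also have "\<dots> = (\<Sum>(i, j, q, r)\<in>quad_indices n.
      f (real (i + q) / real n, real (j + r) / real n) * quad_weight \<beta> n x z (i, j, q, r))"
    by (simp only: sum.Sigma finite_atMost finite_SigmaI Ball_def simp_thms split_def,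
      rule sum.reindex_bij_witness [where i = "\<lambda>(i, j, q, r). (i + q, j + r, i, j)"
        and j = "\<lambda>(k, l, i, j). (i, j, k - i, l - j)"])
      (auto simp: quad_indices_def quad_weight_def xz C_def s_def ac_simps)
  finally show ?thesis .
qed

text \<open>\<open>f\<close> enters only through its values at grid points, so the image is a
  polynomial in the coordinates.\<close>

lemma continuous_on_cheney_sharma: "continuous_on S (cheney_sharma \<beta> n f)"
proof -
  have "continuous_on UNIV (abel_factor \<beta> j)" for j
    unfolding abel_factor_def by (cases j) (auto intro!: continuous_intros)
  then have abel: "continuous_on S (\<lambda>x. abel_factor \<beta> j (g x))" if "continuous_on S g" for g :: "real \<times> real \<Rightarrow> real" and j
    using continuous_on_compose2 that by blast
  show ?thesis
    unfolding cheney_sharma_def case_prod_unfold by (intro continuous_intros abel)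
qed

text \<open>At the origin every term with \<open>k1 > 0\<close> or \<open>k2 > 0\<close> vanishes,
  and the remaining one carries the factor \<open>f (0, 0)\<close>.\<close>

lemma cheney_sharma_at_zero:
  assumes "f (0, 0) = 0"
  shows "cheney_sharma \<beta> n f (0, 0) = 0"
  unfolding cheney_sharma_altdef using assms by (simp add: abel_poly_at_0 sum.neutral)

lemma div_mem_simplex2:
  "i + j \<le> n \<Longrightarrow> n \<ge> 1 \<Longrightarrow> (real i / real n, real j / real n) \<in> simplex2"
  by (simp add: simplex2_def flip: add_divide_distrib of_nat_add)

theorem theorem4:
  fixes \<beta> :: real and \<omega> :: "real \<times> real \<Rightarrow> real"
  assumes "\<beta> \<ge> 0" and "modulus_of_continuity \<omega>"
  shows "\<forall>n::nat. n \<ge> 1 \<longrightarrow> modulus_of_continuity (cheney_sharma \<beta> n \<omega>)"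
proof (intro allI impI)
  fix n :: nat
  assume n: "n \<ge> 1"
  note div_mem = div_mem_simplex2 [OF _ n]
  have nonneg: "\<omega> u \<ge> 0" if "u \<in> simplex2" for u
    using assms(2) that by (auto simp: modulus_of_continuity_def)
  have zero: "\<omega> (0, 0) = 0"
    using assms(2) by (simp add: modulus_of_continuity_def)
  have mono: "\<omega> v \<le> \<omega> u" if "u \<in> simplex2" "v \<in> simplex2" "v \<le> u" for u v
    using assms(2) that by (auto simp: modulus_of_continuity_def)
  have subadd: "\<omega> (u + v) \<le> \<omega> u + \<omega> v" if "u \<in> simplex2" "v \<in> simplex2" "u + v \<in> simplex2" for u v
    using assms(2) that by (auto simp: modulus_of_continuity_def)
  let ?G = "cheney_sharma \<beta> n \<omega>"
  have G_zero: "?G (0, 0) = 0"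
    using zero by (rule cheney_sharma_at_zero)
  have G_le_add: "?G x \<le> ?G (x + z)"
    if "x \<in> simplex2" "z \<in> simplex2" "x + z \<in> simplex2" for x z
    unfolding cheney_sharma_expand_left [of \<beta> n \<omega> x z] cheney_sharma_expand_add
    using quad_weight_nonneg [OF assms(1) that]
    by (intro sum_mono)
      (auto simp: quad_indices_def simp flip: of_nat_add intro!: mult_right_mono mono div_mem divide_right_mono)
  have G_subadd: "?G (x + z) \<le> ?G x + ?G z"
    if "x \<in> simplex2" "z \<in> simplex2" "x + z \<in> simplex2" for x z
  proof -
    have "\<omega> (real (i + q) / real n, real (j + r) / real n)
        \<le> \<omega> (real i / real n, real j / real n) + \<omega> (real q / real n, real r / real n)"
      if "(i, j, q, r) \<in> quad_indices n" for i j q r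
      using subadd [of "(real i / real n, real j / real n)" "(real q / real n, real r / real n)"]
        div_mem [of i j] div_mem [of q r] div_mem [of "i + q" "j + r"] that
      by (simp add: quad_indices_def add_divide_distrib)
    then show ?thesis
      \<comment> \<open>Both expansions are instantiated to the same weight, so the two sums on the
        right merge and the comparison is termwise.\<close>
      unfolding cheney_sharma_expand_left [of \<beta> n \<omega> x z] cheney_sharma_expand_right [of \<beta> n \<omega> z x]
        cheney_sharma_expand_add sum.distrib [symmetric]
      using quad_weight_nonneg [OF assms(1) that]
      by (intro sum_mono) (auto simp flip: distrib_right intro!: mult_right_mono)
  qed
  have G_mono: "?G v \<le> ?G u" if "u \<in> simplex2" "v \<in> simplex2" "v \<le> u" for u v
  proof -
    \<comment> \<open>Monotonicity reduces to adding the increment \<open>u - v\<close>: it is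
      componentwise nonnegative because \<open>v \<le> u\<close>, and its coordinate sum is at most
      that of \<open>u\<close>.\<close>
    have "u - v \<in> simplex2"
      using that by (auto simp: simplex2_def)
    then show ?thesis
      using G_le_add [of v "u - v"] that by simp
  qed
  have G_nonneg: "?G u \<ge> 0" if "u \<in> simplex2" for u
    using G_mono [of u "(0, 0)"] G_zero that by (auto simp: simplex2_def)
  show "modulus_of_continuity ?G"
    unfolding modulus_of_continuity_def
    using continuous_on_cheney_sharma G_nonneg G_zero G_mono G_subadd by blast
qed

end
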